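(* If $\{P_n\}_{n\in\mathbb{N}}$ is a sequence of finite perfect groups with strictly increasing commutator width, and $\omega$ is any non-principal ultrafilter on $\mathbb{N}$, then the ultraproduct $P=\prod_{n\to\omega}P_n$ is not perfect.
   Context: The commutator width of a perfect group $G$ is the smallest integer $d$ such that every element of $G$ is a product of at most $d$ commutators. For a sequence of groups $\{P_n\}_{n\in\mathbb{N}}$ and an ultrafilter $\omega$ on $\mathbb{N}$, the ultraproduct is $\prod_{n\to\omega}P_n:=\left(\prod_{n\in\mathbb{N}}P_n\right)/N_\omega$, where $N_\omega=\{(g_n)_{n\in\mathbb{N}} : \{n: g_n=e\}\in\omega\}$. An ultrafilter is principal if the intersection of all its elements is non-empty. *)

theory Defs
  imports "HOL-Algebra.Product_Groups" "HOL-Algebra.Generated_Groups" "HOL-Library.Extended_Nat"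
begin

definition perfect :: "('a, 'b) monoid_scheme \<Rightarrow> bool" where
  "perfect G \<longleftrightarrow> derived G (carrier G) = carrier G"

definition commutator_products :: "('a, 'b) monoid_scheme \<Rightarrow> nat \<Rightarrow> 'a set" where
  "commutator_products G d =
     {foldr (\<otimes>\<^bsub>G\<^esub>) cs \<one>\<^bsub>G\<^esub> | cs. set cs \<subseteq> derived_set G (carrier G) \<and> length cs \<le> d}"

text \<open>The value is \<open>\<infinity>\<close> (the infimum of the empty set) if no bound on the number of
  commutators exists.\<close>

definition commutator_width :: "('a, 'b) monoid_scheme \<Rightarrow> enat" where
  "commutator_width G = Inf (enat ` {d. carrier G \<subseteq> commutator_products G d})"

text \<open>A family of subsets is represented by the library type of filters: the set \<open>A\<close> is an
  element of the filter \<open>F\<close> iff \<open>eventually (\<lambda>x. x \<in> A) F\<close>. The library constant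
  \<open>principal\<close> is the filter generated by a set; principality of an ultrafilter
  is the predicate below.\<close>

definition is_ultrafilter :: "'i filter \<Rightarrow> bool" where
  "is_ultrafilter F \<longleftrightarrow> F \<noteq> bot \<and>
     (\<forall>A. eventually (\<lambda>x. x \<in> A) F \<or> eventually (\<lambda>x. x \<in> - A) F)"

definition is_principal :: "'i filter \<Rightarrow> bool" where
  "is_principal F \<longleftrightarrow> \<Inter> {A. eventually (\<lambda>x. x \<in> A) F} \<noteq> {}"

definition ultra_kernel :: "'i filter \<Rightarrow> ('i \<Rightarrow> ('a, 'b) monoid_scheme) \<Rightarrow> ('i \<Rightarrow> 'a) set" where
  "ultra_kernel F P =
     {g \<in> carrier (product_group UNIV P). eventually (\<lambda>i. g i = \<one>\<^bsub>P i\<^esub>) F}"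

definition ultraproduct ::
    "'i filter \<Rightarrow> ('i \<Rightarrow> ('a, 'b) monoid_scheme) \<Rightarrow> ('i \<Rightarrow> 'a) set monoid" where
  "ultraproduct F P = product_group UNIV P Mod ultra_kernel F P"

lemma ultra_kernel_normal:
  assumes G: "\<And>i. group (P i)"
  shows "ultra_kernel F P \<lhd> product_group UNIV P"
proof -
  interpret PG: group "product_group UNIV P" using G by simp
  have "subgroup (ultra_kernel F P) (product_group UNIV P)"
  proof (rule PG.subgroupI)
    show "ultra_kernel F P \<subseteq> carrier (product_group UNIV P)"
      by (auto simp: ultra_kernel_def)
    have "\<one>\<^bsub>product_group UNIV P\<^esub> \<in> ultra_kernel F P"
      using PG.one_closed by (simp add: ultra_kernel_def)
    then show "ultra_kernel F P \<noteq> {}" by blast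
  next
    fix a assume a: "a \<in> ultra_kernel F P"
    then have ac: "a \<in> carrier (product_group UNIV P)"
      and ev: "eventually (\<lambda>i. a i = \<one>\<^bsub>P i\<^esub>) F" by (auto simp: ultra_kernel_def)
    have "inv\<^bsub>product_group UNIV P\<^esub> a = (\<lambda>i. inv\<^bsub>P i\<^esub> a i)"
      using ac G by (simp add: restrict_def)
    moreover have "eventually (\<lambda>i. inv\<^bsub>P i\<^esub> a i = \<one>\<^bsub>P i\<^esub>) F"
      using ev by eventually_elim (metis G group.is_monoid monoid.inv_one)
    ultimately show "inv\<^bsub>product_group UNIV P\<^esub> a \<in> ultra_kernel F P"
      using PG.inv_closed[OF ac] unfolding ultra_kernel_def by simp
  next
    fix a b assume a: "a \<in> ultra_kernel F P" and b: "b \<in> ultra_kernel F P"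
    from a have ac: "a \<in> carrier (product_group UNIV P)"
      and ea: "eventually (\<lambda>i. a i = \<one>\<^bsub>P i\<^esub>) F" by (auto simp: ultra_kernel_def)
    from b have bc: "b \<in> carrier (product_group UNIV P)"
      and eb: "eventually (\<lambda>i. b i = \<one>\<^bsub>P i\<^esub>) F" by (auto simp: ultra_kernel_def)
    have "eventually (\<lambda>i. a i \<otimes>\<^bsub>P i\<^esub> b i = \<one>\<^bsub>P i\<^esub>) F"
      using ea eb by eventually_elim (simp add: G group.is_monoid)
    then show "a \<otimes>\<^bsub>product_group UNIV P\<^esub> b \<in> ultra_kernel F P"
      using PG.m_closed[OF ac bc] unfolding ultra_kernel_def by simp
  qed
  moreover have "x \<otimes>\<^bsub>product_group UNIV P\<^esub> h \<otimes>\<^bsub>product_group UNIV P\<^esub> inv\<^bsub>product_group UNIV P\<^esub> x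
      \<in> ultra_kernel F P"
    if x: "x \<in> carrier (product_group UNIV P)" and h: "h \<in> ultra_kernel F P" for x h
  proof -
    from h have hc: "h \<in> carrier (product_group UNIV P)"
      and ev: "eventually (\<lambda>i. h i = \<one>\<^bsub>P i\<^esub>) F" by (auto simp: ultra_kernel_def)
    have xi: "x i \<in> carrier (P i)" for i using x by auto
    have "inv\<^bsub>product_group UNIV P\<^esub> x = (\<lambda>i. inv\<^bsub>P i\<^esub> x i)"
      using x G by (simp add: restrict_def)
    moreover have "eventually (\<lambda>i. x i \<otimes>\<^bsub>P i\<^esub> h i \<otimes>\<^bsub>P i\<^esub> inv\<^bsub>P i\<^esub> x i = \<one>\<^bsub>P i\<^esub>) F"
      using ev by eventually_elim (simp add: G xi group.is_monoid group.r_inv)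
    ultimately show ?thesis
      using PG.m_closed[OF PG.m_closed[OF x hc] PG.inv_closed[OF x]]
      unfolding ultra_kernel_def by simp
  qed
  ultimately show ?thesis
    using PG.normal_inv_iff by blast
qed

lemma group_ultraproduct:
  assumes "\<And>i. group (P i)"
  shows "group (ultraproduct F P)"
  unfolding ultraproduct_def
  by (rule normal.factorgroup_is_group[OF ultra_kernel_normal[OF assms]])

end

theory Submission
  imports Defs
begin

text \<open>
  Every element of a perfect group is a product of finitely many commutators
  (\<open>derived_subset_commutator_products\<close>), and surjective homomorphisms carry the products of
  at most \<open>d\<close> commutators exactly onto those of the target
  (\<open>epi_image_commutator_products\<close>). The latter applies twice to the full direct product: to
  the quotient map onto the ultraproduct, where it serves to lift, and to the coordinate
  projections. Hence if the class of a sequence \<open>g\<close> is a product of at most \<open>d\<close>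
  commutators, then \<open>g\<close> agrees \<open>\<omega>\<close>-almost everywhere with such a product, and
  \<open>g n\<close> is a product of at most \<open>d\<close> commutators of \<open>P n\<close> for
  \<open>\<omega>\<close>-almost every \<open>n\<close> (\<open>coset_commutator_products_eventually\<close>).

  Perfection of the ultraproduct would therefore provide such a uniform \<open>d\<close> for every sequence
  \<open>g\<close>. But strictly increasing widths make the width of \<open>P n\<close> at least \<open>n\<close>, so
  that a sequence can be chosen in which \<open>g n\<close> is not a product of fewer than \<open>n\<close>
  commutators. For this sequence a given \<open>d\<close> can only work at the finitely many indices
  \<open>n \<le> d\<close>, and a non-principal ultrafilter contains no finite set.
\<close>

lemma commutator_products_mono:
  "d \<le> e \<Longrightarrow> commutator_products G d \<subseteq> commutator_products G e"
  unfolding commutator_products_def by force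

lemma (in monoid) foldr_mult_closed:
  "set xs \<subseteq> carrier G \<Longrightarrow> foldr (\<otimes>) xs \<one> \<in> carrier G"
  by (induction xs) auto

lemma (in monoid) foldr_mult_append:
  "set xs \<subseteq> carrier G \<Longrightarrow> set ys \<subseteq> carrier G \<Longrightarrow>
    foldr (\<otimes>) (xs @ ys) \<one> = foldr (\<otimes>) xs \<one> \<otimes> foldr (\<otimes>) ys \<one>"
  by (induction xs) (auto simp: foldr_mult_closed m_assoc)

lemma (in group) commutator_products_mult:
  assumes "x \<in> commutator_products G d" "y \<in> commutator_products G e"
  shows "x \<otimes> y \<in> commutator_products G (d + e)"
proof -
  let ?D = "derived_set G (carrier G)"
  from assms obtain xs ys
    where xs: "x = foldr (\<otimes>) xs \<one>" "set xs \<subseteq> ?D" "length xs \<le> d"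
      and ys: "y = foldr (\<otimes>) ys \<one>" "set ys \<subseteq> ?D" "length ys \<le> e"
    unfolding commutator_products_def by blast
  have "?D \<subseteq> carrier G"
    by (rule derived_set_in_carrier) simp
  then have "x \<otimes> y = foldr (\<otimes>) (xs @ ys) \<one>"
    using xs ys by (simp only: foldr_mult_append[OF subset_trans subset_trans])
  moreover have "set (xs @ ys) \<subseteq> ?D" "length (xs @ ys) \<le> d + e"
    using xs ys by (simp_all only: set_append length_append Un_least add_mono)
  ultimately show ?thesis
    unfolding commutator_products_def by blast
qed

lemma (in group) inv_commutator:
  assumes "c \<in> derived_set G (carrier G)"
  shows "inv c \<in> derived_set G (carrier G)"
proof -
  from assms obtain a b where ab: "a \<in> carrier G" "b \<in> carrier G"
    and c: "c = a \<otimes> b \<otimes> inv a \<otimes> inv b" by blast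
  have "inv c = b \<otimes> a \<otimes> inv b \<otimes> inv a"
    using ab by (simp add: c inv_mult_group m_assoc)
  with ab show ?thesis by blast
qed

text \<open>The derived subgroup is generated by commutators and their inverses; since the inverse of a
  commutator is again a commutator, plain products of commutators exhaust it.\<close>

lemma (in group) derived_subset_commutator_products:
  "derived G (carrier G) \<subseteq> (\<Union>d. commutator_products G d)"
proof
  fix x assume "x \<in> derived G (carrier G)"
  moreover have "c \<in> commutator_products G 1" if "c \<in> derived_set G (carrier G)" for c
  proof -
    have "c \<in> carrier G"
      using that derived_set_in_carrier[of "carrier G"] by blast
    then have "c = foldr (\<otimes>) [c] \<one>" by simp
    moreover have "set [c] \<subseteq> derived_set G (carrier G)" "length [c] \<le> 1"
      using that by (simp_all only: list.set empty_subsetI insert_subset list.size)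
    ultimately show ?thesis
      unfolding commutator_products_def by blast
  qed
  moreover have "\<one> \<in> commutator_products G 0"
    unfolding commutator_products_def by simp
  ultimately show "x \<in> (\<Union>d. commutator_products G d)"
    unfolding derived_def
    by (induction rule: generate.induct)
       (blast intro: inv_commutator commutator_products_mult)+
qed

lemma (in group_hom) epi_image_derived_set:
  assumes surj: "h ` carrier G = carrier H"
  shows "h ` derived_set G (carrier G) = derived_set H (carrier H)"
  unfolding surj[symmetric] by (auto simp: image_UN)

lemma (in group_hom) hom_foldr_mult:
  "set xs \<subseteq> carrier G \<Longrightarrow>
    h (foldr (\<otimes>\<^bsub>G\<^esub>) xs \<one>\<^bsub>G\<^esub>) = foldr (\<otimes>\<^bsub>H\<^esub>) (map h xs) \<one>\<^bsub>H\<^esub>"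
  by (induction xs) (auto simp: G.foldr_mult_closed)

text \<open>A commutator of \<open>H\<close> lifts to a commutator of \<open>G\<close> by lifting its two entries, so
  a product can be lifted factor by factor without increasing the number of commutators.\<close>

lemma (in group_hom) epi_image_commutator_products:
  assumes surj: "h ` carrier G = carrier H"
  shows "h ` commutator_products G d = commutator_products H d"
proof -
  define D where "D = derived_set G (carrier G)"
  have sub: "D \<subseteq> carrier G"
    unfolding D_def by (rule G.derived_set_in_carrier) simp
  have "commutator_products H d =
      {foldr (\<otimes>\<^bsub>H\<^esub>) cs \<one>\<^bsub>H\<^esub> | cs. cs \<in> lists (h ` D) \<and> length cs \<le> d}"
    unfolding D_def commutator_products_def epi_image_derived_set[OF surj]
    by (simp only: in_lists_conv_set subset_iff Ball_def)
  also have "\<dots> = {foldr (\<otimes>\<^bsub>H\<^esub>) (map h cs) \<one>\<^bsub>H\<^esub> | cs. set cs \<subseteq> D \<and> length cs \<le> d}"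
    unfolding lists_image by (fastforce simp: lists_eq_set)
  also have "\<dots> = {h (foldr (\<otimes>\<^bsub>G\<^esub>) cs \<one>\<^bsub>G\<^esub>) | cs. set cs \<subseteq> D \<and> length cs \<le> d}"
    using hom_foldr_mult[OF subset_trans[OF _ sub]] by metis
  also have "\<dots> = h ` commutator_products G d"
    unfolding D_def commutator_products_def by blast
  finally show ?thesis by simp
qed

lemma product_group_projection_epi:
  assumes "\<And>i. group (P i)"
  shows "group_hom (product_group UNIV P) (P i) (\<lambda>x. x i)"
    and "(\<lambda>x. x i) ` carrier (product_group UNIV P) = carrier (P i)"
proof -
  show "group_hom (product_group UNIV P) (P i) (\<lambda>x. x i)"
    using assms by (auto simp: group_hom_def group_hom_axioms_def hom_def)
  have "y \<in> (\<lambda>x. x i) ` carrier (product_group UNIV P)" if "y \<in> carrier (P i)" for y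
    using that assms by (intro image_eqI[of _ _ "(\<lambda>j. \<one>\<^bsub>P j\<^esub>)(i := y)"])
      (auto simp: group.is_monoid monoid.one_closed)
  then show "(\<lambda>x. x i) ` carrier (product_group UNIV P) = carrier (P i)"
    by auto
qed

lemma (in normal) coset_projection_epi:
  shows "group_hom G (G Mod H) (\<lambda>x. H #> x)"
    and "(\<lambda>x. H #> x) ` carrier G = carrier (G Mod H)"
  using r_coset_hom_Mod factorgroup_is_group is_group
  by (auto simp: group_hom_def group_hom_axioms_def carrier_FactGroup)

lemma ultra_kernel_coset_eqD:
  assumes G: "\<And>i. group (P i)"
    and x: "x \<in> carrier (product_group UNIV P)" and y: "y \<in> carrier (product_group UNIV P)"
    and eq: "ultra_kernel F P #>\<^bsub>product_group UNIV P\<^esub> x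
      = ultra_kernel F P #>\<^bsub>product_group UNIV P\<^esub> y"
  shows "eventually (\<lambda>i. x i = y i) F"
proof -
  interpret N: normal "ultra_kernel F P" "product_group UNIV P"
    using G by (rule ultra_kernel_normal)
  have "x \<in> ultra_kernel F P #>\<^bsub>product_group UNIV P\<^esub> y"
    using N.rcos_self[OF x N.subgroup_axioms] eq by simp
  then obtain k where k: "k \<in> ultra_kernel F P" and xk: "x = k \<otimes>\<^bsub>product_group UNIV P\<^esub> y"
    by (auto simp: r_coset_def)
  from k have "eventually (\<lambda>i. k i = \<one>\<^bsub>P i\<^esub>) F"
    by (simp add: ultra_kernel_def)
  then show ?thesis
  proof eventually_elim
    case (elim i)
    have "y i \<in> carrier (P i)" using y by auto
    with elim G show ?case by (simp add: xk group.is_monoid)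
  qed
qed

text \<open>A factorisation of the coset lifts to one single factorisation in the direct product, whose
  coordinates all have the same number of factors; this is why one \<open>d\<close> serves almost all
  coordinates. The lift may differ from \<open>g\<close> itself by an element of the kernel, which is where
  the exceptional coordinates come from.\<close>

lemma coset_commutator_products_eventually:
  assumes G: "\<And>i. group (P i)"
    and g: "g \<in> carrier (product_group UNIV P)"
    and prod: "ultra_kernel F P #>\<^bsub>product_group UNIV P\<^esub> g
      \<in> commutator_products (ultraproduct F P) d"
  shows "eventually (\<lambda>i. g i \<in> commutator_products (P i) d) F"
proof -
  let ?Q = "product_group UNIV P"
  interpret N: normal "ultra_kernel F P" ?Q
    using G by (rule ultra_kernel_normal)
  from prod obtain x where x: "x \<in> commutator_products ?Q d"
    and eq: "ultra_kernel F P #>\<^bsub>?Q\<^esub> g = ultra_kernel F P #>\<^bsub>?Q\<^esub> x"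
    unfolding ultraproduct_def
      group_hom.epi_image_commutator_products[OF N.coset_projection_epi, symmetric] by blast
  have "x \<in> carrier ?Q"
    using x N.foldr_mult_closed N.derived_set_in_carrier[OF subset_refl]
    unfolding commutator_products_def by blast
  then have "eventually (\<lambda>i. g i = x i) F"
    using ultra_kernel_coset_eqD[OF G g _ eq] by blast
  moreover have "x i \<in> commutator_products (P i) d" for i
    unfolding group_hom.epi_image_commutator_products[
        OF product_group_projection_epi[where P = P and i = i, OF G], symmetric]
    using x by blast
  ultimately show ?thesis
    by (simp add: eventually_mono)
qed

lemma less_commutator_width:
  assumes "enat d < commutator_width G"
  shows "\<not> carrier G \<subseteq> commutator_products G d"
proof
  assume "carrier G \<subseteq> commutator_products G d"
  then have "commutator_width G \<le> enat d"
    unfolding commutator_width_def by (intro Inf_lower) blast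
  with assms show False by simp
qed

lemma strict_mono_enat_ge:
  fixes f :: "nat \<Rightarrow> enat"
  assumes "strict_mono f"
  shows "enat n \<le> f n"
proof (induction n)
  case (Suc n)
  also have "f n < f (Suc n)"
    using assms by (simp add: strict_mono_def)
  finally show ?case
    by (simp add: Suc_ile_eq)
qed (simp add: zero_enat_def[symmetric])

text \<open>Bounding all \<open>d < n\<close> instead of \<open>d = n - 1\<close> makes the condition vacuous at
  \<open>n = 0\<close>, where no long element need exist.\<close>

lemma commutator_width_witness:
  assumes "group G" and width: "enat n \<le> commutator_width G"
  shows "\<exists>g\<in>carrier G. \<forall>d<n. g \<notin> commutator_products G d"
proof (cases n)
  case 0
  with assms show ?thesis
    by (auto intro: monoid.one_closed group.is_monoid)
next
  case (Suc m)
  then have "enat m < commutator_width G"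
    using width by (simp add: Suc_ile_eq)
  from less_commutator_width[OF this] obtain g
    where "g \<in> carrier G" "g \<notin> commutator_products G m" by blast
  with Suc show ?thesis
    using commutator_products_mono[of _ m G] by (auto simp: less_Suc_eq_le)
qed

text \<open>A point outside the intersection of all members is omitted by some member, and finitely many
  such members can be intersected.\<close>

lemma not_principal_avoids_finite:
  assumes "\<not> is_principal F" and "finite A"
  shows "eventually (\<lambda>x. x \<notin> A) F"
proof -
  have "eventually (\<lambda>x. x \<noteq> a) F" for a
  proof -
    from assms(1) obtain B where "eventually (\<lambda>x. x \<in> B) F" "a \<notin> B"
      unfolding is_principal_def by blast
    then show ?thesis by (auto elim: eventually_mono)
  qed
  then have "eventually (\<lambda>x. \<forall>a\<in>A. x \<noteq> a) F"
    using \<open>finite A\<close> by (simp add: eventually_ball_finite)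
  then show ?thesis by (auto elim: eventually_mono)
qed

theorem proposition1p5:
  fixes P :: "nat \<Rightarrow> ('a, 'b) monoid_scheme" and \<omega> :: "nat filter"
  assumes "\<And>n. group (P n)"
    and "\<And>n. finite (carrier (P n))"
    and "\<And>n. perfect (P n)"
    and "strict_mono (\<lambda>n. commutator_width (P n))"
    and "is_ultrafilter \<omega>" and "\<not> is_principal \<omega>"
  shows "\<not> perfect (ultraproduct \<omega> P)"
proof
  assume perf: "perfect (ultraproduct \<omega> P)"
  interpret N: normal "ultra_kernel \<omega> P" "product_group UNIV P"
    using assms(1) by (rule ultra_kernel_normal)
  interpret U: group "ultraproduct \<omega> P"
    using assms(1) by (rule group_ultraproduct)
  have "\<exists>g\<in>carrier (P n). \<forall>d<n. g \<notin> commutator_products (P n) d" for n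
    using assms(1) strict_mono_enat_ge[OF assms(4)] by (rule commutator_width_witness)
  then obtain g where g: "\<And>n. g n \<in> carrier (P n)"
    and long: "\<And>n d. d < n \<Longrightarrow> g n \<notin> commutator_products (P n) d"
    by metis
  have gQ: "g \<in> carrier (product_group UNIV P)"
    using g by auto
  have "ultra_kernel \<omega> P #>\<^bsub>product_group UNIV P\<^esub> g \<in> carrier (ultraproduct \<omega> P)"
    unfolding ultraproduct_def using N.coset_projection_epi(2) gQ by blast
  then obtain d where
    "ultra_kernel \<omega> P #>\<^bsub>product_group UNIV P\<^esub> g \<in> commutator_products (ultraproduct \<omega> P) d"
    using perf U.derived_subset_commutator_products unfolding perfect_def by blast
  then have "eventually (\<lambda>n. g n \<in> commutator_products (P n) d) \<omega>"
    by (rule coset_commutator_products_eventually[OF assms(1) gQ])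
  then have "eventually (\<lambda>n. n \<in> {..d}) \<omega>"
    by (rule eventually_mono) (use long not_le in auto)
  moreover have "eventually (\<lambda>n. n \<notin> {..d}) \<omega>"
    using assms(6) by (rule not_principal_avoids_finite) simp
  ultimately have "eventually (\<lambda>n. False) \<omega>"
    by eventually_elim blast
  with assms(5) show False
    by (simp add: is_ultrafilter_def)
qed

end
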